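(* Let $A$ be an $n\times n$ real symmetric positive definite matrix. Let $B$ be an $n \times n$ real symmetric positive definite matrix such that $$\mathbf{v}^T A \mathbf{v} \le \mathbf{v}^T B \mathbf{v} \quad \text{for all } \mathbf{v}\in\mathbb{R}^n$$ (so that $B$ defines an $A$-convergent iteration method for solving $A\mathbf{x}=\mathbf{b}$). Assume that $$\|B\| \le c_0 \|A\| \quad\text{for a constant } c_0 \ge 1.$$ Let $\delta\in(0,1)$ and let $\mathbf{w}\in\mathbb{R}^n$ be any nonzero vector such that $$1 \ge \frac{\|(I-B^{-1}A)\mathbf{w}\|_A^2}{\|\mathbf{w}\|_A^2} \ge 1-\delta .$$ Then $$\|A\mathbf{w}\|^2 \le c_0\,\|A\|\,\delta\,\|\mathbf{w}\|_A^2 .$$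
   Context: For vectors, $\|\cdot\|$ is the Euclidean norm on $\mathbb{R}^n$; for matrices, $\|\cdot\|$ is the induced (spectral) norm. For a symmetric positive definite $A$, $\|\mathbf{w}\|_A=\sqrt{\mathbf{w}^TA\mathbf{w}}$. An invertible matrix $B$ is called $A$-convergent if there is $\varrho<1$ with $\|(I-B^{-1}A)\mathbf{v}\|_A\le\varrho\|\mathbf{v}\|_A$ for all $\mathbf{v}$. *)

theory Defs
  imports "HOL-Analysis.Analysis"
begin

definition sym_pos_def :: "real^'n^'n \<Rightarrow> bool" where
  "sym_pos_def A \<longleftrightarrow> transpose A = A \<and> (\<forall>x. x \<noteq> 0 \<longrightarrow> x \<bullet> (A *v x) > 0)"

definition energy_norm :: "real^'n^'n \<Rightarrow> real^'n \<Rightarrow> real" where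
  "energy_norm A w = sqrt (w \<bullet> (A *v w))"

definition spectral_norm :: "real^'n^'n \<Rightarrow> real" where
  "spectral_norm A = onorm ((*v) A)"

definition iter_matrix :: "real^'n^'n \<Rightarrow> real^'n^'n \<Rightarrow> real^'n^'n" where
  "iter_matrix A B = mat 1 - matrix_inv B ** A"

definition A_convergent :: "real^'n^'n \<Rightarrow> real^'n^'n \<Rightarrow> bool" where
  "A_convergent A B \<longleftrightarrow> invertible B \<and>
     (\<exists>\<rho><1. \<forall>v. energy_norm A (iter_matrix A B *v v) \<le> \<rho> * energy_norm A v)"

lemma sym_pos_def_invertible:
  fixes A :: "real^'n^'n"
  assumes "sym_pos_def A"
  shows "invertible A"
proof -
  have "\<forall>x. A *v x = 0 \<longrightarrow> x = 0"
    using assms unfolding sym_pos_def_def by (metis inner_zero_right less_irrefl)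
  then show ?thesis
    by (simp add: invertible_left_inverse matrix_left_invertible_ker)
qed

(* Symmetry and positive definiteness of B, together with A \<le> B, already give A-convergence;
   it is therefore not needed as an assumption in theorems about such B. *)
lemma A_convergent_if_le:
  fixes A B :: "real^'n^'n"
  assumes A: "sym_pos_def A" and B: "sym_pos_def B"
    and le: "\<And>v. v \<bullet> (A *v v) \<le> v \<bullet> (B *v v)"
  shows "A_convergent A B"
proof -
  have invB: "invertible B" using B by (rule sym_pos_def_invertible)
  define M where "M = matrix_inv B ** A"
  have "B ** matrix_inv B = mat 1"
    using invB unfolding invertible_def matrix_inv_def by (rule someI2_ex) simp
  then have BM: "B *v (M *v v) = A *v v" for v
    unfolding M_def by (metis matrix_mul_assoc matrix_mul_lid matrix_vector_mul_assoc)
  have symA: "x \<bullet> (A *v y) = y \<bullet> (A *v x)" for x y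
    using A unfolding sym_pos_def_def by (metis dot_lmul_matrix inner_commute transpose_matrix_vector)
  have posA: "x \<bullet> (A *v x) > 0" if "x \<noteq> 0" for x using A that unfolding sym_pos_def_def by auto
  have posB: "x \<bullet> (B *v x) > 0" if "x \<noteq> 0" for x using B that unfolding sym_pos_def_def by auto
  have nnA: "x \<bullet> (A *v x) \<ge> 0" for x using posA[of x] by (cases "x = 0") auto
  define f where "f v = ((M *v v) \<bullet> (A *v v)) / (v \<bullet> (A *v v))" for v
  have fB: "(M *v v) \<bullet> (A *v v) = (M *v v) \<bullet> (B *v (M *v v))" for v by (simp add: BM)
  have nz: "\<forall>v\<in>sphere 0 1. v \<bullet> (A *v v) \<noteq> 0"
    using posA by (metis dist_self less_irrefl mem_sphere zero_neq_one)
  have cont: "continuous_on (sphere 0 1) f"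
    unfolding f_def by (intro continuous_intros linear_continuous_on matrix_vector_mul_bounded_linear)
      (use nz in auto)
  have "sphere (0::real^'n) 1 \<noteq> {}" by simp
  then obtain z where z: "z \<in> sphere 0 1" "\<And>v. v \<in> sphere 0 1 \<Longrightarrow> f z \<le> f v"
    using continuous_attains_inf[OF compact_sphere _ cont] by blast
  have z0: "z \<noteq> 0" using z(1) by auto
  have "M *v z \<noteq> 0"
  proof
    assume "M *v z = 0"
    then have "A *v z = 0" using BM[of z] by simp
    then show False using posA[OF z0] by simp
  qed
  then have fz: "f z > 0" unfolding f_def fB using posB posA[OF z0] by simp
  have fge: "f z \<le> f v" if "v \<noteq> 0" for v
  proof -
    have "f ((1 / norm v) *\<^sub>R v) = f v"
      using that posA[OF that] by (simp add: f_def matrix_vector_mult_scaleR)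
    moreover have "(1 / norm v) *\<^sub>R v \<in> sphere 0 1" using that by simp
    ultimately show ?thesis using z(2) by metis
  qed
  have step: "(v - M *v v) \<bullet> (A *v (v - M *v v)) \<le> (1 - f z) * (v \<bullet> (A *v v))" for v
  proof (cases "v = 0")
    case False
    have "(v - M *v v) \<bullet> (A *v (v - M *v v))
        = v \<bullet> (A *v v) - 2 * ((M *v v) \<bullet> (A *v v)) + (M *v v) \<bullet> (A *v (M *v v))"
      using symA[of v "M *v v"] by (simp add: matrix_vector_mult_diff_distrib inner_diff)
    also have "\<dots> \<le> v \<bullet> (A *v v) - (M *v v) \<bullet> (A *v v)"
      using le[of "M *v v"] fB[of v] by simp
    also have "\<dots> = (1 - f v) * (v \<bullet> (A *v v))"
      using posA[OF False] by (simp add: f_def field_simps)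
    also have "\<dots> \<le> (1 - f z) * (v \<bullet> (A *v v))"
      using fge[OF False] nnA by (intro mult_right_mono) auto
    finally show ?thesis .
  qed simp
  have "energy_norm A (iter_matrix A B *v v) \<le> sqrt (1 - f z) * energy_norm A v" for v
  proof -
    have "iter_matrix A B *v v = v - M *v v"
      by (simp add: iter_matrix_def M_def matrix_vector_mult_diff_rdistrib)
    then show ?thesis
      using step[of v] by (simp add: energy_norm_def real_sqrt_mult[symmetric])
  qed
  moreover have "sqrt (1 - f z) < 1" using fz by simp
  ultimately show ?thesis unfolding A_convergent_def using invB by blast
qed

end

theory Submission
  imports Defs
begin

text \<open>
  Write \<open>M = B\<^sup>-\<^sup>1 A\<close> for the preconditioned matrix and \<open>m = M w\<close>, so that \<open>B m = A w\<close>. Expanding the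
  energy of the error after one step and bounding the quadratic term by \<open>A \<le> B\<close> gives
  \<open>\<parallel>w - m\<parallel>\<^sub>A\<^sup>2 \<le> \<parallel>w\<parallel>\<^sub>A\<^sup>2 - m \<bullet> B m\<close>: each step reduces the energy by at least \<open>m \<bullet> B m\<close>
  (lemma \<open>energy_norm_iter_matrix_le\<close>). If the step reduces the energy by at most the fraction
  \<open>\<delta>\<close>, then \<open>m \<bullet> B m \<le> \<delta> \<parallel>w\<parallel>\<^sub>A\<^sup>2\<close>. The residual \<open>A w = B m\<close> is controlled by the same
  quantity, because \<open>B\<^sup>2 \<le> \<parallel>B\<parallel> B\<close> for symmetric positive semidefinite \<open>B\<close>
  (lemma \<open>norm_mult_sq_le_spectral_norm\<close>). Finally \<open>\<parallel>B\<parallel> \<le> c\<^sub>0 \<parallel>A\<parallel>\<close> trades \<open>\<parallel>B\<parallel>\<close> for \<open>\<parallel>A\<parallel>\<close>.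
\<close>

lemma symmetric_inner_swap:
  fixes A :: "real^'n^'n"
  assumes "transpose A = A"
  shows "x \<bullet> (A *v y) = y \<bullet> (A *v x)"
  using assms by (metis dot_lmul_matrix inner_commute transpose_matrix_vector)

lemma sym_pos_def_inner_nonneg:
  assumes "sym_pos_def A"
  shows "0 \<le> x \<bullet> (A *v x)"
  using assms unfolding sym_pos_def_def by (cases "x = 0") (auto intro: less_imp_le)

lemma energy_norm_sq:
  assumes "sym_pos_def A"
  shows "(energy_norm A x)\<^sup>2 = x \<bullet> (A *v x)"
  using sym_pos_def_inner_nonneg[OF assms] by (simp add: energy_norm_def)

lemma norm_mult_le_spectral_norm: "norm (B *v x) \<le> spectral_norm B * norm x"
  unfolding spectral_norm_def by (rule onorm) (rule matrix_vector_mul_bounded_linear)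

text \<open>
  This is the operator inequality \<open>B\<^sup>2 \<le> \<parallel>B\<parallel> B\<close>. It avoids the spectral theorem: positivity of the
  quadratic form at the single vector \<open>\<parallel>B\<parallel> m - B m\<close> already gives it. Among
  the vectors \<open>t m - B m\<close> this choice of \<open>t\<close> makes the bound \<open>\<parallel>B\<parallel> \<parallel>B m\<parallel>\<^sup>2\<close> for the
  \<open>B m\<close>-part of the form cancel exactly half of the cross term \<open>2 t \<parallel>B m\<parallel>\<^sup>2\<close>.
\<close>
lemma norm_mult_sq_le_spectral_norm:
  fixes B :: "real^'n^'n"
  assumes sym: "transpose B = B" and psd: "\<And>x. 0 \<le> x \<bullet> (B *v x)"
  shows "(norm (B *v m))\<^sup>2 \<le> spectral_norm B * (m \<bullet> (B *v m))"
proof (cases "spectral_norm B = 0")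
  case True
  then show ?thesis using norm_mult_le_spectral_norm[of B m] by simp
next
  case False
  define x where "x = B *v m"
  define L where "L = spectral_norm B"
  have L: "L > 0"
    using False onorm_pos_le[OF matrix_vector_mul_bounded_linear[of B]]
    unfolding L_def spectral_norm_def by simp
  have xBx: "x \<bullet> (B *v x) \<le> L * (x \<bullet> x)"
  proof -
    have "x \<bullet> (B *v x) \<le> norm x * norm (B *v x)" by (rule norm_cauchy_schwarz)
    also have "\<dots> \<le> norm x * (L * norm x)"
      unfolding L_def by (intro mult_left_mono norm_mult_le_spectral_norm) simp
    finally show ?thesis by (simp add: dot_square_norm power2_eq_square mult_ac)
  qed
  have "0 \<le> (L *\<^sub>R m - x) \<bullet> (B *v (L *\<^sub>R m - x))" by (rule psd)
  also have "\<dots> = L\<^sup>2 * (m \<bullet> x) - 2 * L * (x \<bullet> x) + x \<bullet> (B *v x)"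
    using symmetric_inner_swap[OF sym, of m x]
    by (simp add: matrix_vector_mult_diff_distrib matrix_vector_mult_scaleR inner_diff
        x_def[symmetric] power2_eq_square algebra_simps)
  also have "\<dots> \<le> L * (L * (m \<bullet> x) - x \<bullet> x)"
    using xBx by (simp add: power2_eq_square algebra_simps)
  finally have "x \<bullet> x \<le> L * (m \<bullet> x)"
    using L by (simp add: zero_le_mult_iff)
  then show ?thesis by (simp add: x_def L_def dot_square_norm)
qed

lemma matrix_inv_mult_vector_right:
  fixes B :: "real^'n^'n"
  assumes "invertible B"
  shows "B *v (matrix_inv B *v y) = y"
proof -
  have "B ** matrix_inv B = mat 1"
    using assms unfolding invertible_def matrix_inv_def by (rule someI2_ex) simp
  then show ?thesis by (simp add: matrix_vector_mul_assoc)
qed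

lemma iter_matrix_mult_vector:
  "iter_matrix A B *v w = w - matrix_inv B *v (A *v w)"
  by (simp add: iter_matrix_def matrix_vector_mult_diff_rdistrib matrix_vector_mul_assoc)

text \<open>
  With \<open>m = B\<^sup>-\<^sup>1 A w\<close>, the cross term of the expanded square is \<open>- 2 (m \<bullet> A w) = - 2 (m \<bullet> B m)\<close>, while
  the quadratic term \<open>m \<bullet> A m\<close> is at most \<open>m \<bullet> B m\<close> and so cancels at most half of it.
\<close>
lemma energy_norm_iter_matrix_le:
  fixes A B :: "real^'n^'n" and w :: "real^'n"
  assumes A: "sym_pos_def A" and invB: "invertible B"
    and le: "\<And>v. v \<bullet> (A *v v) \<le> v \<bullet> (B *v v)"
  defines "m \<equiv> matrix_inv B *v (A *v w)"
  shows "(energy_norm A (iter_matrix A B *v w))\<^sup>2 \<le> (energy_norm A w)\<^sup>2 - m \<bullet> (B *v m)"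
proof -
  have Bm: "B *v m = A *v w"
    unfolding m_def by (rule matrix_inv_mult_vector_right[OF invB])
  have symA: "w \<bullet> (A *v m) = m \<bullet> (A *v w)"
    using A unfolding sym_pos_def_def by (intro symmetric_inner_swap) simp
  have "(energy_norm A (iter_matrix A B *v w))\<^sup>2 = (w - m) \<bullet> (A *v (w - m))"
    by (simp add: energy_norm_sq[OF A] iter_matrix_mult_vector m_def)
  also have "\<dots> = w \<bullet> (A *v w) - 2 * (m \<bullet> (B *v m)) + m \<bullet> (A *v m)"
    using symA by (simp add: Bm matrix_vector_mult_diff_distrib inner_diff)
  also have "\<dots> \<le> w \<bullet> (A *v w) - m \<bullet> (B *v m)"
    using le[of m] by simp
  finally show ?thesis by (simp add: energy_norm_sq[OF A])
qed

theorem theorem3p1: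
  fixes A B :: "real^'n^'n" and w :: "real^'n" and c0 \<delta> :: real
  assumes "sym_pos_def A"
    and "sym_pos_def B"
    and "\<And>v. v \<bullet> (A *v v) \<le> v \<bullet> (B *v v)"
    and "c0 \<ge> 1"
    and "spectral_norm B \<le> c0 * spectral_norm A"
    and "0 < \<delta>" and "\<delta> < 1"
    and "w \<noteq> 0"
    and "1 \<ge> (energy_norm A (iter_matrix A B *v w))\<^sup>2 / (energy_norm A w)\<^sup>2"
    and "(energy_norm A (iter_matrix A B *v w))\<^sup>2 / (energy_norm A w)\<^sup>2 \<ge> 1 - \<delta>"
  shows "(norm (A *v w))\<^sup>2 \<le> c0 * spectral_norm A * \<delta> * (energy_norm A w)\<^sup>2"
proof -
  note A = assms(1) and B = assms(2) and le = assms(3)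
  define m where "m = matrix_inv B *v (A *v w)"
  have invB: "invertible B" using B by (rule sym_pos_def_invertible)
  have Bm: "B *v m = A *v w"
    unfolding m_def by (rule matrix_inv_mult_vector_right[OF invB])
  have Epos: "(energy_norm A w)\<^sup>2 > 0"
    using A \<open>w \<noteq> 0\<close> by (simp add: energy_norm_sq) (simp add: sym_pos_def_def)
  have "(1 - \<delta>) * (energy_norm A w)\<^sup>2 \<le> (energy_norm A (iter_matrix A B *v w))\<^sup>2"
    using assms(10) by (simp only: pos_le_divide_eq[OF Epos])
  also have "\<dots> \<le> (energy_norm A w)\<^sup>2 - m \<bullet> (B *v m)"
    unfolding m_def by (rule energy_norm_iter_matrix_le[OF A invB le])
  finally have mBm: "m \<bullet> (B *v m) \<le> \<delta> * (energy_norm A w)\<^sup>2"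
    by (simp add: algebra_simps)
  have mBm_nonneg: "0 \<le> m \<bullet> (B *v m)" by (rule sym_pos_def_inner_nonneg[OF B])
  have "(norm (A *v w))\<^sup>2 \<le> spectral_norm B * (m \<bullet> (B *v m))"
    using norm_mult_sq_le_spectral_norm[of B m] B sym_pos_def_inner_nonneg[OF B]
    unfolding Bm sym_pos_def_def by blast
  also have "\<dots> \<le> (c0 * spectral_norm A) * (m \<bullet> (B *v m))"
    using assms(5) mBm_nonneg by (rule mult_right_mono)
  also have "\<dots> \<le> (c0 * spectral_norm A) * (\<delta> * (energy_norm A w)\<^sup>2)"
  proof (rule mult_left_mono[OF mBm])
    have "0 \<le> spectral_norm A"
      unfolding spectral_norm_def by (intro onorm_pos_le matrix_vector_mul_bounded_linear)
    then show "0 \<le> c0 * spectral_norm A" using \<open>c0 \<ge> 1\<close> by simp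
  qed
  finally show ?thesis by (simp add: mult.assoc)
qed

end
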